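(* Let $f(\mathbf{x})=\sum_{\mathbf{n}\in\mathbb{Z}^d}a_{\mathbf{n}}\mathbf{x}^{\mathbf{n}}\in\Bbbk[x_1^{\pm1},\dots,x_d^{\pm1}]$ be a Laurent polynomial, let $X_f=\{f=0\}\subset\mathbb{G}_m^d$, and let $\mathscr{T}(f)=\mathscr{T}(X_f)$ be its tropical variety. If $f\neq0$, then $\mathscr{T}(f)$ is equal to the non-differentiability locus of the function $$f^{\tau}\colon\mathbb{R}^d\to\mathbb{R},\qquad f^{\tau}(\mathbf{u})=\min_{\mathbf{n}\in\mathbb{Z}^d}\{v(a_{\mathbf{n}})+\mathbf{u}\cdot\mathbf{n}\},$$ i.e. to the set of $\mathbf{u}\in\mathbb{R}^d$ at which $f^\tau$ is not differentiable. In particular, $\mathscr{T}(f)$ is either empty (when $f$ is a monomial), or is a $\Gamma$-rational polyhedral set of pure dimension $d-1$, or is all of $\mathbb{R}^d$ (when $f=0$).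
   Context: $\Bbbk$ is a field that is complete with respect to a nontrivial non-archimedean norm $|\cdot|$; $v=-\log|\cdot|$ is the corresponding valuation, with values in $\mathbb{R}\cup\{\infty\}$ and $v(0)=\infty$. $\overline{\Bbbk}$ is a fixed algebraic closure, and the norm and $v$ are extended (uniquely) to $\overline{\Bbbk}$. $\Gamma=v(\overline{\Bbbk}^\times)\subset\mathbb{R}$. $\mathbb{G}_m^d=\operatorname{Spec}\Bbbk[x_1^{\pm1},\dots,x_d^{\pm1}]$, and $\mathbf{x}^{\mathbf{n}}=x_1^{n_1}\cdots x_d^{n_d}$. Define $\operatorname{val}\colon(\overline{\Bbbk}^\times)^d\to\mathbb{R}^d$ by $\operatorname{val}(a_1,\dots,a_d)=(v(a_1),\dots,v(a_d))$. For a closed subscheme $X\subset\mathbb{G}_m^d$, the tropical variety $\mathscr{T}(X)$ is the closure of $\operatorname{val}(X(\overline{\Bbbk}))$ in $\mathbb{R}^d$. A monomial is a Laurent polynomial $a\,\mathbf{x}^{\mathbf{n}}$ with $a\in\Bbbk^\times$. A convex polyhedron in $\mathbb{R}^d$ is a subset given by a finite system of inequalities $\sum_{j=1}^d b_{ij}u_j\ge c_i$, $i=1,\dots,r$; it is $\Gamma$-rational if one can choose $b_{ij}\in\mathbb{Z}$ and $c_i\in\Gamma$ (it need not have full dimension). A $\Gamma$-rational polyhedral set is a finite union of $\Gamma$-rational convex polyhedra; it is of pure dimension $r$ if all its maximal polyhedra have dimension $r$. *)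

theory Defs
  imports
    "HOL-Analysis.Analysis"
    "HOL-Library.Poly_Mapping"
    "HOL-Computational_Algebra.Polynomial"
begin

(* The class real_normed_field is of no use here: it makes the field an algebra over the reals,
   and no such field is non-archimedean. The norm is therefore an explicit function. *)

locale nonarch_norm =
  fixes N :: "'a::field \<Rightarrow> real"
  assumes nonneg: "N x \<ge> 0"
    and eq_zero_iff: "N x = 0 \<longleftrightarrow> x = 0"
    and mult: "N (x * y) = N x * N y"
    and ultrametric: "N (x + y) \<le> max (N x) (N y)"

locale complete_nonarch_field = nonarch_norm +
  assumes nontrivial: "\<exists>x. x \<noteq> 0 \<and> N x \<noteq> 1"
    and complete: "Metric_space.mcomplete UNIV (\<lambda>x y. N (x - y))"

locale algebraic_closure =
  fixes \<iota> :: "'k::field \<Rightarrow> 'K::alg_closed_field"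
  assumes hom_add: "\<iota> (x + y) = \<iota> x + \<iota> y"
    and hom_mult: "\<iota> (x * y) = \<iota> x * \<iota> y"
    and hom_one: "\<iota> 1 = 1"
    and algebraic: "\<exists>p. p \<noteq> 0 \<and> poly (map_poly \<iota> p) z = 0"

definition valuation :: "('a::field \<Rightarrow> real) \<Rightarrow> 'a \<Rightarrow> ereal" where
  "valuation N x = (if x = 0 then \<infinity> else ereal (- ln (N x)))"

definition value_group :: "('a::field \<Rightarrow> real) \<Rightarrow> real set" where
  "value_group N = {c. \<exists>x. x \<noteq> 0 \<and> valuation N x = ereal c}"

(* real_of_ereal does no harm here: val is applied to points with nonzero coordinates only. *)
definition val :: "('a::field \<Rightarrow> real) \<Rightarrow> 'a ^ 'd \<Rightarrow> real ^ 'd" where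
  "val N x = (\<chi> i. real_of_ereal (valuation N (x $ i)))"

(* Finitely supported coefficient functions on the group int^'d, with the convolution product of
   Poly_Mapping, form the ring of Laurent polynomials in variables indexed by 'd. *)
type_synonym ('d, 'k) laurent_poly = "(int ^ 'd) \<Rightarrow>\<^sub>0 'k"

definition is_monomial :: "('d::finite, 'k::field) laurent_poly \<Rightarrow> bool" where
  "is_monomial f \<longleftrightarrow> (\<exists>n a. a \<noteq> 0 \<and> f = Poly_Mapping.single n a)"

definition laurent_eval ::
    "('k::field \<Rightarrow> 'K::field) \<Rightarrow> ('d::finite, 'k) laurent_poly \<Rightarrow> 'K ^ 'd \<Rightarrow> 'K" where
  "laurent_eval \<iota> f x =
     (\<Sum>n \<in> Poly_Mapping.keys f. \<iota> (Poly_Mapping.lookup f n) * (\<Prod>i\<in>UNIV. (x $ i) powi (n $ i)))"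

(* A closed subscheme X of the torus is presented by a set S of equations, which may be its ideal;
   replacing S by the ideal that it generates does not change the points with values in 'K. *)
definition torus_points ::
    "('k::field \<Rightarrow> 'K::field) \<Rightarrow> ('d::finite, 'k) laurent_poly set \<Rightarrow> ('K ^ 'd) set" where
  "torus_points \<iota> S = {x. (\<forall>i. x $ i \<noteq> 0) \<and> (\<forall>f\<in>S. laurent_eval \<iota> f x = 0)}"

definition tropical_variety ::
    "('k::field \<Rightarrow> 'K::field) \<Rightarrow> ('K \<Rightarrow> real) \<Rightarrow> ('d::finite, 'k) laurent_poly set
      \<Rightarrow> (real ^ 'd) set" where
  "tropical_variety \<iota> N S = closure (val N ` torus_points \<iota> S)"

definition int_vec :: "int ^ 'd \<Rightarrow> real ^ 'd" where
  "int_vec n = (\<chi> i. of_int (n $ i))"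

(* The minimum is over all exponents n; as only finitely many of the terms differ from infinity,
   it is the minimum of a finite set. It is finite precisely when f is nonzero. *)
definition tropicalization ::
    "('k::field \<Rightarrow> real) \<Rightarrow> ('d::finite, 'k) laurent_poly \<Rightarrow> real ^ 'd \<Rightarrow> real" where
  "tropicalization N f u =
     real_of_ereal (MIN n. valuation N (Poly_Mapping.lookup f n) + ereal (u \<bullet> int_vec n))"

lemma finite_range_tropical_terms:
  "finite (range (\<lambda>n. valuation N (Poly_Mapping.lookup f n) + ereal (u \<bullet> int_vec n)))"
    (is "finite (range ?t)")
proof (rule finite_subset)
  have "?t n = \<infinity>" if "n \<notin> Poly_Mapping.keys f" for n
    using that by (simp add: valuation_def in_keys_iff)
  then show "range ?t \<subseteq> insert \<infinity> (?t ` Poly_Mapping.keys f)"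
    by blast
qed simp

definition rational_polyhedron :: "real set \<Rightarrow> (real ^ 'd::finite) set \<Rightarrow> bool" where
  "rational_polyhedron \<Gamma> P \<longleftrightarrow>
     (\<exists>H :: ((int ^ 'd) \<times> real) set. finite H \<and> snd ` H \<subseteq> \<Gamma> \<and>
        P = {u. \<forall>(b, c)\<in>H. int_vec b \<bullet> u \<ge> c})"

(* "Maximal" refers to the members of a decomposition. Maximality among all polyhedra contained in
   the set would be a different notion: the standard tropical plane in R^3 contains lines that lie
   in no 2-dimensional convex subset of it. *)
definition pure_rational_polyhedral_set ::
    "real set \<Rightarrow> int \<Rightarrow> (real ^ 'd::finite) set \<Rightarrow> bool" where
  "pure_rational_polyhedral_set \<Gamma> r S \<longleftrightarrow>
     (\<exists>F. finite F \<and> (\<forall>P\<in>F. rational_polyhedron \<Gamma> P) \<and> S = \<Union>F \<and>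
        (\<forall>P\<in>F. (\<forall>Q\<in>F. P \<subseteq> Q \<longrightarrow> Q = P) \<longrightarrow> aff_dim P = r))"

end

theory Submission
  imports Defs
begin

text \<open>
  Write $t_n(u) = v(a_n) + u \cdot n$ for the exponents $n$ in the support of $f \neq 0$, so that
  the tropicalization is the minimum of finitely many affine functions with distinct linear parts.
  All the sets in the theorem are compared with the corner locus, the set of points where this
  minimum is attained at least twice. The minimum fails to be differentiable exactly there
  (\<open>corner_locus_eq_nondifferentiable\<close>): away from corners it is locally a single affine function,
  while at a corner it touches two affine functions with different gradients from below.

  If $x$ is a zero of $f$ in the torus, the terms of $f(x)$ have valuations $t_n(\mathrm{val}(x))$,
  and a sum with a unique term of smallest valuation cannot vanish. So $\mathrm{val}(x)$ is a corner
  (\<open>val_zero_in_corner_locus\<close>), and the corner locus is closed.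

  The converse is reduced to polynomials in one variable. Fix an integer vector $w$ whose products
  with the exponents of $f$ are distinct. On a curve $y \mapsto (a_i y^{w_i})_i$ the Laurent
  polynomial $f$ becomes, up to a power of $y$, a polynomial $g$ with the coefficients
  $a_n a^n$, and no two of them are merged. If $g$ has no root in the annulus
  $-\epsilon \le v(y) \le \epsilon$, then one and the same term of $g$ dominates on the whole
  annulus (\<open>dominant_coeff_if_no_root_in_annulus\<close>). This means that a single $t_k$ is the strict
  minimum along the segment $\{p + s w : |s| \le \epsilon\}$, where $p = \mathrm{val}(a)$. When $p$ is
  close to a corner $u$ this is absurd: some $t_l$ with $l \neq k$ is minimal at $u$, hence nearly
  minimal at $p$, and it decreases relative to $t_k$ with slope at least $1$ in one of the directions
  $w$, $-w$. So every line in direction $w$ through a point $p$ close to $u$ with coordinates in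
  the value group meets $\mathrm{val}(X_f)$ near $u$ (\<open>val_zero_near_corner\<close>). The value
  group is dense because it is nontrivial and divisible, so such $p$ exist and $u$ lies in the closure of $\mathrm{val}(X_f)$.

  The same lemma gives purity. The corner locus is the finite union of the rational polyhedra where
  two given terms tie for the minimum, each of dimension at most $d - 1$. Near a corner that lies on
  no polyhedron of dimension $d - 1$, choose $p$ so that the line through $p$ in direction $w$ avoids
  all the polyhedra of smaller dimension; the points $p$ to be excluded form a negligible closed set.
  That line would still have to meet the corner locus, a contradiction (\<open>corner_in_facet\<close>).

  If $f$ has at least two terms, so has $g$, and a nonzero root of $g$ shows that $X_f$ is not empty.
  For $f = 0$ the claim is the density of the value group.
\<close>

section \<open>Non-archimedean norms\<close>

context nonarch_norm
begin

lemma zero: "N 0 = 0"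
  by (simp add: eq_zero_iff)

lemma pos: "x \<noteq> 0 \<Longrightarrow> N x > 0"
  using nonneg[of x] eq_zero_iff[of x] by linarith

lemma one: "N 1 = 1"
  using mult[of 1 1] pos[of 1] by simp

lemma minus: "N (- x) = N x"
proof -
  have "N (- 1) * N (- 1) = 1"
    using mult[of "- 1" "- 1"] one by simp
  then have "N (- 1) = 1"
    using nonneg[of "- 1"] by (simp add: square_eq_1_iff)
  then show ?thesis
    using mult[of "- 1" x] by simp
qed

lemma add_eq_of_less: "N x < N y \<Longrightarrow> N (x + y) = N y"
  using ultrametric[of x y] ultrametric[of "x + y" "- x"] minus[of x] by auto

lemma power: "N (x ^ n) = N x ^ n"
  by (induction n) (auto simp: one mult)

lemma inverse: "N (inverse x) = inverse (N x)"
proof (cases "x = 0")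
  case False
  then have "N x * N (inverse x) = 1"
    using mult[of x "inverse x"] one by simp
  then show ?thesis
    by (simp add: inverse_unique)
qed (simp add: zero)

lemma power_int: "N (x powi k) = N x powi k"
  by (cases "k \<ge> 0") (auto simp: power_int_def power inverse)

lemma prod: "N (\<Prod>i\<in>A. g i) = (\<Prod>i\<in>A. N (g i))"
  by (induction A rule: infinite_finite_induct) (auto simp: one mult)

lemma sum_less:
  assumes "finite A" "\<And>k. k \<in> A \<Longrightarrow> N (z k) < c" "0 < c"
  shows "N (\<Sum>k\<in>A. z k) < c"
  using assms
proof (induction A rule: finite_induct)
  case (insert k A)
  then show ?case
    using ultrametric[of "z k" "\<Sum>k\<in>A. z k"] by (simp add: le_less_trans)
qed (simp add: zero)

lemma sum_eq_0_not_dominant: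
  assumes "finite A" "(\<Sum>k\<in>A. z k) = 0" "n \<in> A" "z n \<noteq> 0"
  obtains m where "m \<in> A" "m \<noteq> n" "N (z n) \<le> N (z m)"
proof -
  have "z n = - (\<Sum>k\<in>A - {n}. z k)"
    using assms by (simp add: sum.remove[of A n] eq_neg_iff_add_eq_0)
  then have "\<not> N (\<Sum>k\<in>A - {n}. z k) < N (z n)"
    by (simp add: minus)
  then show thesis
    using sum_less[of "A - {n}" z "N (z n)"] assms pos that by fastforce
qed

text \<open>
  On the circle of radius $\rho \neq N(r)$ one of the two terms of $X - r$ strictly dominates the
  other, so if the $j$-th term of $h$ dominates, then the product of the two dominant terms dominates
  in $(X - r) h$: all other contributions are smaller by the ultrametric inequality. The index moves
  up by one exactly when $r$ lies inside the circle.
\<close>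
lemma dominant_coeff_linear_mult:
  assumes "0 < \<rho>" "N r \<noteq> \<rho>"
    and dom: "\<And>i. i \<noteq> j \<Longrightarrow> N (coeff h i) * \<rho> ^ i < N (coeff h j) * \<rho> ^ j"
    and J: "J = (if N r < \<rho> then Suc j else j)"
    and "i \<noteq> J"
  shows "N (coeff ([:- r, 1:] * h) i) * \<rho> ^ i < N (coeff ([:- r, 1:] * h) J) * \<rho> ^ J"
proof -
  define H where "H i = N (coeff h i) * \<rho> ^ i" for i
  define G where "G i = N (coeff ([:- r, 1:] * h) i) * \<rho> ^ i" for i
  have H_nonneg: "H i \<ge> 0" for i
    using assms(1) nonneg by (simp add: H_def)
  have dom': "i \<noteq> j \<Longrightarrow> H i < H j" for i
    using dom by (simp add: H_def)
  then have le: "H i \<le> H j" for i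
    by (cases "i = j") (auto simp: less_imp_le)
  have "H j > 0"
    using dom'[of "Suc j"] H_nonneg[of "Suc j"] by simp
  have G0: "G 0 = N r * H 0"
    by (simp add: G_def H_def mult minus)
  have coeff_Suc: "coeff ([:- r, 1:] * h) (Suc i) = coeff h i + - (r * coeff h (Suc i))" for i
    by simp
  have G_le: "G (Suc i) \<le> max (\<rho> * H i) (N r * H (Suc i))" for i
  proof -
    have "G (Suc i) \<le> max (N (coeff h i)) (N (- (r * coeff h (Suc i)))) * \<rho> ^ Suc i"
      unfolding G_def coeff_Suc using assms(1) by (intro mult_right_mono ultrametric) auto
    also have "\<dots> = max (N (coeff h i) * \<rho> ^ Suc i) (N (- (r * coeff h (Suc i))) * \<rho> ^ Suc i)"
      using assms(1) by (subst max_mult_distrib_right) simp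
    also have "\<dots> = max (\<rho> * H i) (N r * H (Suc i))"
      by (simp add: H_def mult minus mult_ac)
    finally show ?thesis .
  qed
  show ?thesis
  proof (cases "N r < \<rho>")
    case True
    have less: "N r * H i < \<rho> * H j" for i
      using mult_left_mono[OF le[of i] nonneg[of r]] mult_strict_right_mono[OF True \<open>H j > 0\<close>]
      by linarith
    have "N (r * coeff h (Suc j)) < N (coeff h j)"
      using less[of "Suc j"] assms(1) by (simp add: H_def mult mult_ac)
    then have "G J = \<rho> * H j"
      using True add_eq_of_less[of "- (r * coeff h (Suc j))" "coeff h j"]
      unfolding J G_def by (simp add: minus H_def add.commute)
    moreover have "G i < \<rho> * H j"
    proof (cases i)
      case 0
      then show ?thesis using G0 less by simp
    next
      case (Suc i')
      then have "\<rho> * H i' < \<rho> * H j"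
        using True J \<open>i \<noteq> J\<close> dom' assms(1) by simp
      then show ?thesis
        using G_le[of i'] less[of i] Suc by simp
    qed
    ultimately show ?thesis by (simp add: G_def)
  next
    case False
    then have gt: "\<rho> < N r" using assms(2) by simp
    then have less: "\<rho> * H i < N r * H j" for i
      using mult_left_mono[OF le[of i], of \<rho>] mult_strict_right_mono[OF gt \<open>H j > 0\<close>] assms(1)
      by linarith
    have "G j = N r * H j"
    proof (cases j)
      case 0
      then show ?thesis using G0 by simp
    next
      case (Suc j')
      have "N (coeff h j') < N (- (r * coeff h j))"
        using less[of j'] assms(1) Suc by (simp add: H_def mult minus mult_ac)
      from add_eq_of_less[OF this] show ?thesis
        unfolding G_def H_def Suc coeff_Suc by (simp add: mult minus Suc)
    qed
    moreover have "G i < N r * H j"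
    proof (cases i)
      case 0
      then show ?thesis
        using G0 dom'[of 0] J False \<open>i \<noteq> J\<close> gt assms(1) by simp
    next
      case (Suc i')
      then have "N r * H i < N r * H j"
        using False J \<open>i \<noteq> J\<close> dom' gt assms(1) by simp
      then show ?thesis
        using G_le[of i'] less[of i'] Suc by simp
    qed
    ultimately show ?thesis using J False by (simp add: G_def)
  qed
qed

end

text \<open>
  The part of the theory of Newton polygons that is needed. Splitting off the roots one by one shows
  that the dominant index is the number of roots inside the inner circle, counted with multiplicity.
  This number does not depend on $\rho$, and so a single index $j$ serves the whole annulus.
\<close>
lemma dominant_coeff_if_no_root_in_annulus:
  fixes N :: "'K::alg_closed_field \<Rightarrow> real"
  assumes "nonarch_norm N" "0 < \<rho>\<^sub>1"
    and "p \<noteq> 0" "\<And>y. poly p y = 0 \<Longrightarrow> N y \<notin> {\<rho>\<^sub>1..\<rho>\<^sub>2}"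
  obtains j where
    "\<And>\<rho> i. \<rho> \<in> {\<rho>\<^sub>1..\<rho>\<^sub>2} \<Longrightarrow> i \<noteq> j \<Longrightarrow> N (coeff p i) * \<rho> ^ i < N (coeff p j) * \<rho> ^ j"
proof -
  interpret nonarch_norm N by fact
  have "\<exists>j. \<forall>\<rho>\<in>{\<rho>\<^sub>1..\<rho>\<^sub>2}. \<forall>i. i \<noteq> j \<longrightarrow> N (coeff p i) * \<rho> ^ i < N (coeff p j) * \<rho> ^ j"
    using assms(3,4)
  proof (induction "degree p" arbitrary: p)
    case 0
    then obtain c where "p = [:c:]" "c \<noteq> 0"
      by (metis degree_eq_zeroE pCons_0_0)
    then show ?case
      by (intro exI[of _ 0]) (auto simp: zero pos coeff_pCons split: nat.splits)
  next
    case (Suc d)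
    obtain r where r: "poly p r = 0"
      using alg_closed_imp_poly_has_root[of p] Suc.hyps(2) by auto
    then obtain h where h: "p = [:- r, 1:] * h"
      by (auto simp: poly_eq_0_iff_dvd)
    have "h \<noteq> 0" using h Suc.prems by auto
    have "degree p = degree [:- r, 1:] + degree h"
      unfolding h by (rule degree_mult_eq) (use \<open>h \<noteq> 0\<close> in auto)
    then have "d = degree h" using Suc.hyps(2) by simp
    moreover have "poly h y = 0 \<Longrightarrow> N y \<notin> {\<rho>\<^sub>1..\<rho>\<^sub>2}" for y
      using Suc.prems(2)[of y] h by simp
    ultimately obtain j where
      j: "\<And>\<rho> i. \<rho> \<in> {\<rho>\<^sub>1..\<rho>\<^sub>2} \<Longrightarrow> i \<noteq> j \<Longrightarrow> N (coeff h i) * \<rho> ^ i < N (coeff h j) * \<rho> ^ j"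
      using Suc.hyps(1)[of h] \<open>h \<noteq> 0\<close> by blast
    define J where "J = (if N r < \<rho>\<^sub>1 then Suc j else j)"
    have "N (coeff p i) * \<rho> ^ i < N (coeff p J) * \<rho> ^ J" if \<rho>: "\<rho> \<in> {\<rho>\<^sub>1..\<rho>\<^sub>2}" and "i \<noteq> J" for \<rho> i
    proof -
      have out: "N r < \<rho>\<^sub>1 \<or> \<rho>\<^sub>2 < N r"
        using Suc.prems(2)[OF r] by auto
      then have "J = (if N r < \<rho> then Suc j else j)" "N r \<noteq> \<rho>"
        using \<rho> by (auto simp: J_def)
      then show ?thesis
        unfolding h using \<rho> \<open>i \<noteq> J\<close> j assms(2) by (intro dominant_coeff_linear_mult) auto
    qed
    then show ?case by blast
  qed
  then show thesis using that by blast
qed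

section \<open>The tropical hypersurface as a corner locus\<close>

text \<open>
  Real-valued, since it is applied to exponents $n$ in the support of $f$ only; outside the support
  the valuation of the coefficient is infinite, and the value below is meaningless.
\<close>
definition tropical_term ::
    "('k::field \<Rightarrow> real) \<Rightarrow> ('d::finite, 'k) laurent_poly \<Rightarrow> int ^ 'd \<Rightarrow> real ^ 'd \<Rightarrow> real" where
  "tropical_term N f n u = - ln (N (Poly_Mapping.lookup f n)) + u \<bullet> int_vec n"

definition tie_cell ::
    "('k::field \<Rightarrow> real) \<Rightarrow> ('d::finite, 'k) laurent_poly \<Rightarrow> int ^ 'd \<Rightarrow> int ^ 'd \<Rightarrow> (real ^ 'd) set"
  where
  "tie_cell N f n m = {u. tropical_term N f n u = tropical_term N f m u \<and>
     (\<forall>k\<in>Poly_Mapping.keys f. tropical_term N f n u \<le> tropical_term N f k u)}"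

definition corner_locus ::
    "('k::field \<Rightarrow> real) \<Rightarrow> ('d::finite, 'k) laurent_poly \<Rightarrow> (real ^ 'd) set" where
  "corner_locus N f =
     (\<Union>(n, m)\<in>{(n, m) \<in> Poly_Mapping.keys f \<times> Poly_Mapping.keys f. n \<noteq> m}. tie_cell N f n m)"

lemma int_vec_diff: "int_vec (n - m) = int_vec n - int_vec m"
  by (simp add: int_vec_def vec_eq_iff)

lemma int_vec_eq_iff: "int_vec n = int_vec m \<longleftrightarrow> n = m"
  by (simp add: int_vec_def vec_eq_iff)

lemma inner_int_vec: "int_vec n \<bullet> int_vec w = of_int (\<Sum>i\<in>UNIV. n $ i * w $ i)"
  by (simp add: int_vec_def inner_vec_def)

lemma tropical_term_add:
  "tropical_term N f n (p + s *\<^sub>R int_vec w) =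
     tropical_term N f n p + s * (int_vec n \<bullet> int_vec w)"
  by (simp add: tropical_term_def inner_add_left inner_commute[of "int_vec n"])

lemma continuous_on_tropical_term: "continuous_on S (tropical_term N f n)"
  unfolding tropical_term_def by (intro continuous_intros)

lemma corner_locus_iff:
  "u \<in> corner_locus N f \<longleftrightarrow>
     (\<exists>n\<in>Poly_Mapping.keys f. \<exists>m\<in>Poly_Mapping.keys f. n \<noteq> m \<and>
        tropical_term N f n u = tropical_term N f m u \<and>
        (\<forall>k\<in>Poly_Mapping.keys f. tropical_term N f n u \<le> tropical_term N f k u))"
  by (auto simp: corner_locus_def tie_cell_def)

lemma minimal_term_exists:
  fixes f :: "('d::finite, 'k::field) laurent_poly"
  assumes "f \<noteq> 0"
  obtains n where "n \<in> Poly_Mapping.keys f"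
    "\<And>k. k \<in> Poly_Mapping.keys f \<Longrightarrow> tropical_term N f n u \<le> tropical_term N f k u"
proof -
  let ?K = "Poly_Mapping.keys f"
  have "?K \<noteq> {}" using assms by simp
  then have "arg_min_on (\<lambda>n. tropical_term N f n u) ?K \<in> ?K"
    by (intro arg_min_if_finite) simp_all
  moreover have "tropical_term N f (arg_min_on (\<lambda>n. tropical_term N f n u) ?K) u \<le>
      tropical_term N f k u" if "k \<in> ?K" for k
    by (rule arg_min_least) (use that in auto)
  ultimately show thesis by (rule that)
qed

lemma not_in_corner_locusE:
  fixes f :: "('d::finite, 'k::field) laurent_poly"
  assumes "f \<noteq> 0" "u \<notin> corner_locus N f"
  obtains n where "n \<in> Poly_Mapping.keys f"
    "\<And>k. k \<in> Poly_Mapping.keys f \<Longrightarrow> k \<noteq> n \<Longrightarrow> tropical_term N f n u < tropical_term N f k u"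
proof -
  obtain n where "n \<in> Poly_Mapping.keys f"
    "\<And>k. k \<in> Poly_Mapping.keys f \<Longrightarrow> tropical_term N f n u \<le> tropical_term N f k u"
    using minimal_term_exists[OF assms(1)] by blast
  then show thesis
    using assms(2) that[of n] unfolding corner_locus_iff by (metis order_le_less)
qed

lemma closed_tie_cell: "closed (tie_cell N f n m)"
proof -
  have "tie_cell N f n m = {u. tropical_term N f n u = tropical_term N f m u} \<inter>
     (\<Inter>k\<in>Poly_Mapping.keys f. {u. tropical_term N f n u \<le> tropical_term N f k u})"
    by (auto simp: tie_cell_def)
  then show ?thesis
    by (auto intro!: closed_INT closed_Collect_eq closed_Collect_le closed_Int
        continuous_on_tropical_term)
qed

lemma closed_corner_locus: "closed (corner_locus N f)"
  unfolding corner_locus_def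
  by (rule closed_UN)
     (auto simp: closed_tie_cell intro: finite_subset[of _ "Poly_Mapping.keys f \<times> Poly_Mapping.keys f"])

text \<open>
  Exponents outside the support contribute $\infty$ to the minimum over all of $\mathbb{Z}^d$, so a
  term that is minimal among those of the support attains it.
\<close>
lemma tropicalization_eq_minimal_term:
  assumes "n \<in> Poly_Mapping.keys f"
    and "\<And>k. k \<in> Poly_Mapping.keys f \<Longrightarrow> tropical_term N f n u \<le> tropical_term N f k u"
  shows "tropicalization N f u = tropical_term N f n u"
proof -
  have term_eq: "valuation N (Poly_Mapping.lookup f k) + ereal (u \<bullet> int_vec k) =
      (if k \<in> Poly_Mapping.keys f then ereal (tropical_term N f k u) else \<infinity>)" for k
    by (simp add: valuation_def tropical_term_def in_keys_iff)
  have "(MIN k. valuation N (Poly_Mapping.lookup f k) + ereal (u \<bullet> int_vec k)) =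
      ereal (tropical_term N f n u)"
  proof (rule Min_eqI[OF finite_range_tropical_terms])
    show "ereal (tropical_term N f n u) \<in>
        range (\<lambda>k. valuation N (Poly_Mapping.lookup f k) + ereal (u \<bullet> int_vec k))"
      using assms(1) by (intro image_eqI[of _ _ n]) (simp_all add: term_eq)
  qed (use assms(2) in \<open>auto simp: term_eq split: if_splits\<close>)
  then show ?thesis
    by (simp add: tropicalization_def)
qed

lemma tropicalization_le_term:
  assumes "n \<in> Poly_Mapping.keys f"
  shows "tropicalization N f u \<le> tropical_term N f n u"
proof -
  have "f \<noteq> 0" using assms by auto
  then obtain m where "m \<in> Poly_Mapping.keys f"
    "\<And>k. k \<in> Poly_Mapping.keys f \<Longrightarrow> tropical_term N f m u \<le> tropical_term N f k u"
    using minimal_term_exists[of f] by blast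
  then show ?thesis
    using tropicalization_eq_minimal_term[of m f N u] assms by simp
qed

lemma has_derivative_tropical_term:
  "(tropical_term N f n has_derivative (\<lambda>h. h \<bullet> int_vec n)) (at u)"
  unfolding tropical_term_def by (auto intro!: derivative_eq_intros)

lemma derivative_of_minorant_at_contact:
  fixes g T :: "'v::real_normed_vector \<Rightarrow> real"
  assumes "(g has_derivative D) (at u)" "(T has_derivative E) (at u)"
    and "\<And>x. g x \<le> T x" "g u = T u"
  shows "D = E"
proof -
  have "((\<lambda>x. T x - g x) has_derivative (\<lambda>h. E h - D h)) (at u)"
    by (intro has_derivative_diff assms)
  then have "(\<lambda>h. E h - D h) = (\<lambda>h. 0)"
    by (rule has_derivative_local_min) (use assms(3,4) in auto)
  then show ?thesis
    by (metis diff_eq_diff_eq diff_self ext)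
qed

text \<open>
  At a corner the minimum lies below two affine functions that it touches, so a derivative would
  have to equal both of their gradients, and these are different exponents. Off the corner locus the
  unique minimal term stays minimal in a neighbourhood.
\<close>
theorem corner_locus_eq_nondifferentiable:
  fixes f :: "('d::finite, 'k::field) laurent_poly"
  assumes "f \<noteq> 0"
  shows "corner_locus N f = {u. \<not> (tropicalization N f) differentiable (at u)}"
proof -
  have "\<not> (tropicalization N f) differentiable (at u)" if "u \<in> corner_locus N f" for u
  proof
    assume "(tropicalization N f) differentiable (at u)"
    then obtain D where D: "(tropicalization N f has_derivative D) (at u)"
      by (auto simp: differentiable_def)
    obtain n m where nm: "n \<in> Poly_Mapping.keys f" "m \<in> Poly_Mapping.keys f" "n \<noteq> m"
      "tropical_term N f n u = tropical_term N f m u"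
      "\<And>k. k \<in> Poly_Mapping.keys f \<Longrightarrow> tropical_term N f n u \<le> tropical_term N f k u"
      using \<open>u \<in> corner_locus N f\<close> unfolding corner_locus_iff by blast
    have contact: "tropicalization N f u = tropical_term N f n u"
      by (rule tropicalization_eq_minimal_term) (use nm in auto)
    have "D = (\<lambda>h. h \<bullet> int_vec n)" "D = (\<lambda>h. h \<bullet> int_vec m)"
      using derivative_of_minorant_at_contact[OF D has_derivative_tropical_term]
        tropicalization_le_term nm contact by metis+
    then have "int_vec n = int_vec m"
      by (metis vector_eq_ldot)
    then show False
      using nm(3) by (simp add: int_vec_eq_iff)
  qed
  moreover have "(tropicalization N f) differentiable (at u)" if u: "u \<notin> corner_locus N f" for u
  proof -
    obtain n where n: "n \<in> Poly_Mapping.keys f"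
      "\<And>k. k \<in> Poly_Mapping.keys f \<Longrightarrow> k \<noteq> n \<Longrightarrow> tropical_term N f n u < tropical_term N f k u"
      using not_in_corner_locusE[OF assms u] by blast
    define U where "U = (\<Inter>k\<in>Poly_Mapping.keys f - {n}.
      {x. tropical_term N f n x < tropical_term N f k x})"
    have "open U"
      unfolding U_def
      by (auto intro!: open_INT open_Collect_less continuous_on_tropical_term)
    moreover have "u \<in> U" using n by (auto simp: U_def)
    moreover have "tropicalization N f x = tropical_term N f n x" if "x \<in> U" for x
    proof (rule tropicalization_eq_minimal_term[OF n(1)])
      show "tropical_term N f n x \<le> tropical_term N f k x" if "k \<in> Poly_Mapping.keys f" for k
        using that \<open>x \<in> U\<close> by (cases "k = n") (auto simp: U_def less_imp_le)
    qed
    ultimately have "(tropicalization N f has_derivative (\<lambda>h. h \<bullet> int_vec n)) (at u)"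
      using has_derivative_transform_within_open[OF has_derivative_tropical_term] by metis
    then show ?thesis
      by (auto simp: differentiable_def)
  qed
  ultimately show ?thesis by blast
qed


section \<open>Monomial curves through the torus\<close>

lemma ln_power_int:
  fixes x :: real
  assumes "x > 0"
  shows "ln (x powi k) = of_int k * ln x"
  using assms by (metis exp_ln exp_power_int ln_exp)

text \<open>
  Take $w = (1, M, M^2, \ldots)$ on the moment curve: for $n \neq m$ the product of $n - m$ with $w$
  is a nonzero polynomial in $M$, and an integer $M$ can be chosen that is a root of none of the
  finitely many polynomials arising in this way.
\<close>
lemma separating_integer_direction:
  fixes A :: "(int ^ 'd::finite) set"
  assumes "finite A"
  obtains w :: "int ^ 'd" where "inj_on (\<lambda>n. \<Sum>i\<in>UNIV. n $ i * w $ i) A"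
proof -
  obtain e :: "'d \<Rightarrow> nat" where e: "inj e"
    using finite_imp_inj_to_nat_seg[OF finite_class.finite_UNIV] by blast
  define q where "q n = (\<Sum>i\<in>UNIV. monom (n $ i) (e i))" for n :: "int ^ 'd"
  have coeff_q: "coeff (q n) (e i) = n $ i" for n i
  proof -
    have "coeff (q n) (e i) = (\<Sum>j\<in>UNIV. if j = i then n $ j else 0)"
      unfolding q_def coeff_sum by (rule sum.cong) (use e in \<open>auto simp: inj_eq\<close>)
    then show ?thesis by simp
  qed
  define Q where "Q = (\<Prod>(n, m)\<in>{(n, m) \<in> A \<times> A. n \<noteq> m}. q (n - m))"
  have fin: "finite {(n, m) \<in> A \<times> A. n \<noteq> m}"
    using assms by (auto intro: finite_subset[of _ "A \<times> A"])
  have "q (n - m) \<noteq> 0" if "n \<noteq> m" for n m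
    using that coeff_q[of "n - m"] by (metis coeff_0 eq_iff_diff_eq_0 vec_eq_iff zero_index)
  then have "Q \<noteq> 0"
    unfolding Q_def using fin by (auto simp: prod_zero_iff)
  then obtain M where M: "poly Q M \<noteq> 0"
    using ex_new_if_finite[OF infinite_UNIV_int poly_roots_finite[of Q]] by auto
  define w :: "int ^ 'd" where "w = (\<chi> i. M ^ e i)"
  have poly_q: "poly (q n) M = (\<Sum>i\<in>UNIV. n $ i * w $ i)" for n
    by (simp add: q_def w_def poly_sum poly_monom)
  have "inj_on (\<lambda>n. \<Sum>i\<in>UNIV. n $ i * w $ i) A"
  proof (rule inj_onI, rule ccontr)
    fix n m
    assume nm: "n \<in> A" "m \<in> A" "n \<noteq> m"
      and eq: "(\<Sum>i\<in>UNIV. n $ i * w $ i) = (\<Sum>i\<in>UNIV. m $ i * w $ i)"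
    have "poly (q (n - m)) M \<noteq> 0"
      using M nm fin by (auto simp: Q_def poly_prod prod_zero_iff)
    then show False
      using eq by (simp add: poly_q algebra_simps sum_subtractf)
  qed
  then show thesis using that by blast
qed

definition laurent_term ::
    "('k::field \<Rightarrow> 'K::field) \<Rightarrow> ('d::finite, 'k) laurent_poly \<Rightarrow> 'K ^ 'd \<Rightarrow> int ^ 'd \<Rightarrow> 'K" where
  "laurent_term \<iota> f x n = \<iota> (Poly_Mapping.lookup f n) * (\<Prod>i\<in>UNIV. (x $ i) powi (n $ i))"

definition monomial_curve :: "'K::field ^ 'd::finite \<Rightarrow> int ^ 'd \<Rightarrow> 'K \<Rightarrow> 'K ^ 'd" where
  "monomial_curve a w y = (\<chi> i. a $ i * y powi (w $ i))"

lemma laurent_eval_eq_sum_terms: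
  "laurent_eval \<iota> f x = (\<Sum>n\<in>Poly_Mapping.keys f. laurent_term \<iota> f x n)"
  by (simp add: laurent_eval_def laurent_term_def)

lemma laurent_term_monomial_curve:
  assumes "y \<noteq> 0"
  shows "laurent_term \<iota> f (monomial_curve a w y) n =
    laurent_term \<iota> f a n * y powi (\<Sum>i\<in>UNIV. n $ i * w $ i)"
proof -
  have "(\<Prod>i\<in>S. y powi (n $ i * w $ i)) = y powi (\<Sum>i\<in>S. n $ i * w $ i)" for S
    using assms by (induction S rule: infinite_finite_induct) (auto simp: power_int_add)
  then show ?thesis
    by (simp add: laurent_term_def monomial_curve_def power_int_mult_distrib prod.distrib
        flip: power_int_mult mult.commute[of "w $ _"])
qed

text \<open>
  Along the curve the $n$-th term of $f$ is multiplied by $y^{n \cdot w}$. Because the exponents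
  $n \cdot w$ are distinct, no two terms are added up, and dividing by the smallest power of $y$
  leaves a polynomial whose coefficients are zeros and the terms of $f$ at $a$.
\<close>
lemma restriction_to_monomial_curve:
  fixes f :: "('d::finite, 'k::field) laurent_poly" and \<iota> :: "'k \<Rightarrow> 'K::field"
  assumes inj: "inj_on (\<lambda>n. \<Sum>i\<in>UNIV. n $ i * w $ i) (Poly_Mapping.keys f)"
  obtains g :: "'K poly" and e :: "int ^ 'd \<Rightarrow> nat" where
    "inj_on e (Poly_Mapping.keys f)"
    "\<forall>n\<in>Poly_Mapping.keys f. coeff g (e n) = laurent_term \<iota> f a n"
    "\<forall>j. coeff g j \<noteq> 0 \<longrightarrow> j \<in> e ` Poly_Mapping.keys f"
    "\<forall>y. y \<noteq> 0 \<longrightarrow> poly g y = 0 \<longleftrightarrow> laurent_eval \<iota> f (monomial_curve a w y) = 0"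
proof -
  let ?K = "Poly_Mapping.keys f"
  define slope where "slope n = (\<Sum>i\<in>UNIV. n $ i * w $ i)" for n
  define c where "c = Min (slope ` ?K)"
  define e where "e n = nat (slope n - c)" for n
  define g where "g = (\<Sum>n\<in>?K. monom (laurent_term \<iota> f a n) (e n))"
  have e: "int (e n) = slope n - c" if "n \<in> ?K" for n
    using that by (simp add: e_def c_def)
  have inj_e: "inj_on e ?K"
  proof (rule inj_onI)
    fix n m assume "n \<in> ?K" "m \<in> ?K" "e n = e m"
    then have "slope n = slope m" using e[of n] e[of m] by simp
    then show "n = m"
      using inj \<open>n \<in> ?K\<close> \<open>m \<in> ?K\<close> by (simp add: slope_def inj_on_def)
  qed
  have coeff_g: "coeff g j = (\<Sum>n\<in>?K. if e n = j then laurent_term \<iota> f a n else 0)" for j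
    by (simp add: g_def coeff_sum)
  have "coeff g (e n) = laurent_term \<iota> f a n" if "n \<in> ?K" for n
  proof -
    have "coeff g (e n) = (\<Sum>m\<in>?K. if m = n then laurent_term \<iota> f a m else 0)"
      unfolding coeff_g by (rule sum.cong) (use inj_e that in \<open>auto simp: inj_on_def\<close>)
    then show ?thesis using that by simp
  qed
  moreover have "j \<in> e ` ?K" if "coeff g j \<noteq> 0" for j
  proof (rule ccontr)
    assume "j \<notin> e ` ?K"
    then have "coeff g j = 0"
      unfolding coeff_g by (intro sum.neutral) auto
    then show False using that by simp
  qed
  moreover have "poly g y = 0 \<longleftrightarrow> laurent_eval \<iota> f (monomial_curve a w y) = 0" if "y \<noteq> 0" for y
  proof -
    have "laurent_term \<iota> f a n * y ^ e n * y powi c = laurent_term \<iota> f (monomial_curve a w y) n"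
      if "n \<in> ?K" for n
      using e[OF that] \<open>y \<noteq> 0\<close>
      by (simp add: laurent_term_monomial_curve slope_def mult.assoc
          flip: power_int_of_nat power_int_add)
    then have "poly g y * y powi c = laurent_eval \<iota> f (monomial_curve a w y)"
      by (simp add: g_def poly_sum poly_monom laurent_eval_eq_sum_terms sum_distrib_right)
    then show ?thesis
      using that by (metis mult_eq_0_iff power_int_eq_0_iff)
  qed
  ultimately show thesis
    using that[of e g] inj_e by blast
qed

text \<open>
  After division by the power of the variable that accounts for the root $0$, a polynomial with at
  least two nonzero coefficients is still not constant.
\<close>
lemma nonzero_root_if_two_coeffs:
  fixes g :: "'K::alg_closed_field poly"
  assumes "coeff g i \<noteq> 0" "coeff g j \<noteq> 0" "i \<noteq> j"
  obtains y where "y \<noteq> 0" "poly g y = 0"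
proof -
  have "g \<noteq> 0" using assms(1) by auto
  then obtain q where q: "g = [:- 0, 1:] ^ order 0 g * q" "\<not> [:- 0, 1:] dvd q"
    using order_decomp by blast
  have "degree q > 0"
  proof (rule ccontr)
    assume "\<not> degree q > 0"
    then obtain b where "q = [:b:]"
      by (auto elim: degree_eq_zeroE)
    then have "g = monom b (order 0 g)"
      using q(1) by (simp add: monom_altdef)
    then have "coeff g l = (if order 0 g = l then b else 0)" for l
      by (metis coeff_monom)
    then show False
      using assms by (metis (full_types))
  qed
  then obtain y where y: "poly q y = 0"
    using alg_closed_imp_poly_has_root by blast
  moreover have "y \<noteq> 0"
    using y q(2) by (metis poly_eq_0_iff_dvd)
  moreover have "poly g y = 0"
    using y by (subst q(1)) simp
  ultimately show thesis using that by blast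
qed

section \<open>Sweeping a low-dimensional set along a line\<close>

text \<open>
  The lines in direction $w$ that meet a set of codimension at least two fill a set of codimension at
  least one. This bounds the lines to be avoided in the proof of purity.
\<close>
lemma negligible_sweep:
  fixes P :: "'a::euclidean_space set"
  assumes "aff_dim P < int DIM('a) - 1"
  obtains C where "closed C" "negligible C" "\<And>p s. p + s *\<^sub>R w \<in> P \<Longrightarrow> p \<in> C"
proof (cases "P = {}")
  case True
  then show thesis using that[of "{}"] by simp
next
  case False
  then obtain x where "x \<in> P" by blast
  define C where "C = affine hull (insert (x + w) P)"
  have "aff_dim C \<le> aff_dim P + 1"
    by (simp add: C_def aff_dim_insert)
  then have "interior C = {}"
    using assms by (intro low_dim_interior) simp
  then have "negligible C"
    by (simp add: C_def negligible_convex_interior affine_imp_convex)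
  moreover have "p \<in> C" if "p + s *\<^sub>R w \<in> P" for p s
  proof -
    have "(p + s *\<^sub>R w) + (- s) *\<^sub>R ((x + w) - x) \<in> C"
      unfolding C_def using that \<open>x \<in> P\<close> by (intro mem_affine_3_minus) (auto intro: hull_inc)
    then show ?thesis by simp
  qed
  moreover have "closed C"
    by (simp add: C_def)
  ultimately show thesis using that by blast
qed

section \<open>The valuation map on the torus\<close>

locale valued_algebraic_closure =
  k: complete_nonarch_field nk + algebraic_closure \<iota> + K: nonarch_norm nK
  for nk :: "'k::field \<Rightarrow> real" and \<iota> :: "'k \<Rightarrow> 'K::alg_closed_field" and nK :: "'K \<Rightarrow> real" +
  assumes norm_extends: "nK (\<iota> a) = nk a"
begin

lemma embedding_eq_0_iff: "\<iota> c = 0 \<longleftrightarrow> c = 0"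
  by (metis K.eq_zero_iff k.eq_zero_iff norm_extends)

lemma val_nth: "x $ i \<noteq> 0 \<Longrightarrow> val nK x $ i = - ln (nK (x $ i))"
  by (simp add: val_def valuation_def)

text \<open>
  The bridge between algebra and convex geometry: at a point of the torus the terms of $f$ have the
  valuations $t_n$ at the image of that point.
\<close>
lemma norm_laurent_term:
  fixes f :: "('d::finite, 'k) laurent_poly"
  assumes "n \<in> Poly_Mapping.keys f" "\<And>i. x $ i \<noteq> 0"
  shows "nK (laurent_term \<iota> f x n) = exp (- tropical_term nk f n (val nK x))"
proof -
  have "nK (x $ i powi (n $ i)) = exp (- (val nK x $ i * of_int (n $ i)))" for i
  proof -
    have "nK (x $ i) = exp (- (val nK x $ i))"
      using assms(2)[of i] K.pos by (simp add: val_nth)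
    then show ?thesis
      by (simp add: K.power_int exp_power_int mult.commute)
  qed
  then have "nK (\<Prod>i\<in>UNIV. x $ i powi (n $ i)) = exp (- (val nK x \<bullet> int_vec n))"
    by (simp add: K.prod inner_vec_def int_vec_def sum_negf flip: exp_sum)
  moreover have "nk (Poly_Mapping.lookup f n) > 0"
    using assms(1) by (auto intro: k.pos simp: in_keys_iff)
  ultimately show ?thesis
    by (simp add: laurent_term_def tropical_term_def K.mult norm_extends exp_diff exp_minus
        divide_inverse)
qed

lemma laurent_term_nonzero:
  assumes "n \<in> Poly_Mapping.keys f" "\<And>i. x $ i \<noteq> 0"
  shows "laurent_term \<iota> f x n \<noteq> 0"
  using assms by (simp add: laurent_term_def embedding_eq_0_iff in_keys_iff)

lemma val_monomial_curve:
  assumes "\<And>i. a $ i \<noteq> 0" "y \<noteq> 0"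
  shows "val nK (monomial_curve a w y) = val nK a + (- ln (nK y)) *\<^sub>R int_vec w"
proof -
  have "nK y > 0"
    using assms by (auto intro: K.pos)
  then show ?thesis
    using assms
    by (simp add: vec_eq_iff val_nth monomial_curve_def int_vec_def K.mult K.power_int K.eq_zero_iff
        ln_mult ln_power_int)
qed

lemma val_zero_in_corner_locus:
  assumes "f \<noteq> 0" "x \<in> torus_points \<iota> {f}"
  shows "val nK x \<in> corner_locus nk f"
proof (rule ccontr)
  assume "val nK x \<notin> corner_locus nk f"
  then obtain n where n: "n \<in> Poly_Mapping.keys f"
    "\<And>k. k \<in> Poly_Mapping.keys f \<Longrightarrow> k \<noteq> n \<Longrightarrow>
      tropical_term nk f n (val nK x) < tropical_term nk f k (val nK x)"
    using not_in_corner_locusE[OF assms(1)] by blast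
  have x: "x $ i \<noteq> 0" "(\<Sum>n\<in>Poly_Mapping.keys f. laurent_term \<iota> f x n) = 0" for i
    using assms(2) by (auto simp: torus_points_def laurent_eval_eq_sum_terms)
  obtain m where "m \<in> Poly_Mapping.keys f" "m \<noteq> n"
    "nK (laurent_term \<iota> f x n) \<le> nK (laurent_term \<iota> f x m)"
    by (rule K.sum_eq_0_not_dominant[OF _ x(2) n(1)]) (use laurent_term_nonzero[OF n(1) x(1)] in auto)
  then show False
    using n(2)[of m] norm_laurent_term[OF n(1) x(1)] norm_laurent_term[OF _ x(1)] by simp
qed

text \<open>
  Taking $q$-th roots of an element of nonzero valuation gives elements of arbitrarily small nonzero
  valuation, whose integer multiples come close to every real number.
\<close>
lemma valuation_dense:
  assumes "\<epsilon> > 0"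
  obtains x where "x \<noteq> 0" "\<bar>- ln (nK x) - c\<bar> < \<epsilon>"
proof -
  obtain a0 where "a0 \<noteq> 0" "nk a0 \<noteq> 1"
    using k.nontrivial by blast
  then have a: "\<iota> a0 \<noteq> 0" "nK (\<iota> a0) \<noteq> 1" "nK (\<iota> a0) > 0"
    using norm_extends k.pos embedding_eq_0_iff by auto
  obtain q :: nat where q: "\<bar>ln (nK (\<iota> a0))\<bar> / \<epsilon> < real q" "q > 0"
    by (metis reals_Archimedean2 gr0I divide_nonneg_pos abs_ge_zero assms of_nat_0 not_less)
  obtain b where b: "b ^ q = \<iota> a0"
    using nth_root_exists[OF q(2)] by blast
  then have "b \<noteq> 0" using a(1) q(2) by (metis power_0_left neq0_conv)
  then have "nK b > 0" by (rule K.pos)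
  define d where "d = ln (nK b)"
  have "real q * d = ln (nK (\<iota> a0))"
    using b \<open>nK b > 0\<close> by (metis K.power d_def ln_realpow)
  then have "\<bar>real q * d\<bar> < \<epsilon> * real q" "d \<noteq> 0"
    using a q assms by (auto simp: field_simps)
  then have "\<bar>d\<bar> < \<epsilon>" using q(2) by (simp add: abs_mult mult.commute)
  \<comment> \<open>The sign comes from \<open>- ln (nK (b powi j)) = - j * d\<close>.\<close>
  define j where "j = \<lfloor>- c / d\<rfloor>"
  have "\<bar>- c / d - of_int j\<bar> < 1"
    unfolding j_def by linarith
  then have "\<bar>(- c / d - of_int j) * d\<bar> < 1 * \<bar>d\<bar>"
    unfolding abs_mult using \<open>d \<noteq> 0\<close> by (intro mult_strict_right_mono) auto
  then have "\<bar>- c - of_int j * d\<bar> < \<epsilon>"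
    using \<open>d \<noteq> 0\<close> \<open>\<bar>d\<bar> < \<epsilon>\<close> by (simp add: left_diff_distrib)
  moreover have "ln (nK (b powi j)) = of_int j * d"
    using \<open>nK b > 0\<close> by (simp add: K.power_int d_def ln_power_int)
  ultimately show thesis
    using that[of "b powi j"] \<open>b \<noteq> 0\<close> by (simp add: abs_minus_commute)
qed

lemma val_dense:
  fixes u :: "real ^ 'd::finite"
  assumes "\<epsilon> > 0"
  obtains a where "\<And>i. a $ i \<noteq> 0" "norm (val nK a - u) < \<epsilon>"
proof -
  define \<delta> where "\<delta> = \<epsilon> / real CARD('d)"
  have "\<delta> > 0" using assms by (simp add: \<delta>_def)
  then have "\<exists>x. x \<noteq> 0 \<and> \<bar>- ln (nK x) - u $ i\<bar> < \<delta>" for i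
    using valuation_dense by metis
  then obtain z where z: "\<And>i. z i \<noteq> 0" "\<And>i. \<bar>- ln (nK (z i)) - u $ i\<bar> < \<delta>"
    by metis
  define a where "a = (\<chi> i. z i)"
  have "norm (val nK a - u) \<le> (\<Sum>i\<in>UNIV. \<bar>(val nK a - u) $ i\<bar>)"
    by (rule norm_le_l1_cart)
  also have "\<dots> < (\<Sum>i\<in>(UNIV :: 'd set). \<delta>)"
    using z by (intro sum_strict_mono) (auto simp: a_def val_nth)
  finally show thesis
    using that[of a] z(1) by (simp add: a_def \<delta>_def)
qed

section \<open>Lifting corners to zeros\<close>

text \<open>
  If the restriction $g$ of $f$ to the curve through $a$ had no root $y$ with
  $|v(y)| \le \epsilon$, one term $t_k$ would be strictly smaller than every other one along the
  segment from $p - \epsilon w$ to $p + \epsilon w$. As $u$ is a corner, some $t_l$ with $l \neq k$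
  satisfies $t_l(u) \le t_k(u)$. Both exponents have norm at most $B$, so
  $t_l(p) - t_k(p) \le 2 B |p - u| \le \epsilon$. On the other hand, the integer slopes of $t_l$ and $t_k$
  along $w$ differ, so that $t_k < t_l$ at both ends of the segment forces
  $t_l(p) - t_k(p) > \epsilon$.
\<close>
lemma val_zero_near_corner_on_line:
  fixes f :: "('d::finite, 'k) laurent_poly"
  assumes inj: "inj_on (\<lambda>n. \<Sum>i\<in>UNIV. n $ i * w $ i) (Poly_Mapping.keys f)"
    and u: "u \<in> corner_locus nk f" and "\<epsilon> > 0"
  obtains \<delta> where "\<delta> > 0"
    "\<And>a. (\<And>i. a $ i \<noteq> 0) \<Longrightarrow> norm (val nK a - u) < \<delta> \<Longrightarrow>
      \<exists>s x. \<bar>s\<bar> \<le> \<epsilon> \<and> x \<in> torus_points \<iota> {f} \<and> val nK x = val nK a + s *\<^sub>R int_vec w"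
proof -
  let ?K = "Poly_Mapping.keys f"
  let ?t = "tropical_term nk f"
  have "bounded (int_vec ` ?K)"
    by (intro finite_imp_bounded finite_imageI finite_keys)
  then obtain B where "B > 0" "\<forall>v \<in> int_vec ` ?K. norm v \<le> B"
    unfolding bounded_pos by blast
  then have B: "B > 0" "\<And>n. n \<in> ?K \<Longrightarrow> norm (int_vec n) \<le> B"
    by simp_all
  define \<delta> where "\<delta> = \<epsilon> / (2 * B)"
  have "\<exists>s x. \<bar>s\<bar> \<le> \<epsilon> \<and> x \<in> torus_points \<iota> {f} \<and> val nK x = val nK a + s *\<^sub>R int_vec w"
    if a: "\<And>i. a $ i \<noteq> 0" and near: "norm (val nK a - u) < \<delta>" for a
  proof (rule ccontr)
    assume none: "\<not> ?thesis"
    define p where "p = val nK a"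
    obtain g e where e: "inj_on e ?K"
      and g: "\<forall>n\<in>?K. coeff g (e n) = laurent_term \<iota> f a n"
        "\<forall>j. coeff g j \<noteq> 0 \<longrightarrow> j \<in> e ` ?K"
        "\<forall>y. y \<noteq> 0 \<longrightarrow> poly g y = 0 \<longleftrightarrow> laurent_eval \<iota> f (monomial_curve a w y) = 0"
      by (rule restriction_to_monomial_curve[OF inj, of \<iota> a])
    have norm_g: "nK (coeff g (e n)) = exp (- ?t n p)" if "n \<in> ?K" for n
      using that a by (simp add: g(1) norm_laurent_term p_def)
    obtain n m where nm: "n \<in> ?K" "m \<in> ?K" "n \<noteq> m" "?t n u = ?t m u"
      "\<And>k. k \<in> ?K \<Longrightarrow> ?t n u \<le> ?t k u"
      using u unfolding corner_locus_iff by blast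
    have "g \<noteq> 0"
      using norm_g[OF nm(1)] by (auto simp: K.zero)
    have no_root: "nK y \<notin> {exp (- \<epsilon>)..exp \<epsilon>}" if "poly g y = 0" for y
    proof
      assume y: "nK y \<in> {exp (- \<epsilon>)..exp \<epsilon>}"
      then have "nK y > 0" using exp_gt_zero[of "- \<epsilon>"] by (simp del: exp_gt_zero)
      then have "y \<noteq> 0" by (auto simp: K.zero)
      have "ln (nK y) \<in> {- \<epsilon>..\<epsilon>}"
        using y \<open>nK y > 0\<close> ln_le_cancel_iff[of "nK y" "exp \<epsilon>"] by (simp add: ln_ge_iff)
      then have "\<bar>- ln (nK y)\<bar> \<le> \<epsilon>"
        by (simp add: abs_le_iff)
      moreover have "monomial_curve a w y \<in> torus_points \<iota> {f}"
        using a \<open>y \<noteq> 0\<close> g(3) that by (simp add: torus_points_def monomial_curve_def)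
      ultimately show False
        using none val_monomial_curve[OF a \<open>y \<noteq> 0\<close>, of w] by blast
    qed
    obtain j where
      j: "\<And>\<rho> i. \<rho> \<in> {exp (- \<epsilon>)..exp \<epsilon>} \<Longrightarrow> i \<noteq> j \<Longrightarrow> nK (coeff g i) * \<rho> ^ i < nK (coeff g j) * \<rho> ^ j"
      using dominant_coeff_if_no_root_in_annulus[OF K.nonarch_norm_axioms _ \<open>g \<noteq> 0\<close> no_root]
      by (metis exp_gt_zero)
    \<comment> \<open>A vanishing term cannot dominate strictly; \<open>1\<close> is a radius in the annulus.\<close>
    have "coeff g j \<noteq> 0"
    proof
      assume "coeff g j = 0"
      then have "nK (coeff g (Suc j)) * 1 ^ Suc j < 0"
        using j[of 1 "Suc j"] \<open>\<epsilon> > 0\<close> by (simp add: K.zero)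
      then show False using K.nonneg[of "coeff g (Suc j)"] by simp
    qed
    then obtain k where k: "k \<in> ?K" "j = e k"
      using g(2) by blast
    obtain l where l: "l \<in> ?K" "l \<noteq> k" "?t l u \<le> ?t k u"
      using nm k(1) by metis
    have "e l \<noteq> e k"
      using e l k by (auto simp: inj_on_def)
    have cmp: "?t k p + s * real (e k) < ?t l p + s * real (e l)" if "\<bar>s\<bar> = \<epsilon>" for s
    proof -
      have "exp (- ?t l p) * exp (- s) ^ e l < exp (- ?t k p) * exp (- s) ^ e k"
        using j[of "exp (- s)" "e l"] that \<open>e l \<noteq> e k\<close> k l(1) by (simp add: norm_g abs_if split: if_splits)
      then show ?thesis
        by (simp add: mult.commute flip: exp_of_nat_mult exp_add)
    qed
    \<comment> \<open>Whichever slope is larger, the inequality at one of the two ends gives this bound.\<close>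
    have "?t l p - ?t k p > \<epsilon> * \<bar>real (e l) - real (e k)\<bar>"
      using cmp[of \<epsilon>] cmp[of "- \<epsilon>"] \<open>\<epsilon> > 0\<close> by (auto simp: abs_if algebra_simps)
    moreover have "\<epsilon> * \<bar>real (e l) - real (e k)\<bar> \<ge> \<epsilon> * 1"
      using \<open>e l \<noteq> e k\<close> \<open>\<epsilon> > 0\<close> by (intro mult_left_mono) linarith+
    moreover have "?t l p - ?t k p \<le> \<epsilon>"
    proof -
      have "?t l p - ?t k p = ?t l u - ?t k u + (p - u) \<bullet> (int_vec l - int_vec k)"
        by (simp add: tropical_term_def inner_diff_left inner_diff_right)
      also have "\<dots> \<le> (p - u) \<bullet> (int_vec l - int_vec k)"
        using l(3) by simp
      also have "\<dots> \<le> norm (p - u) * norm (int_vec l - int_vec k)"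
        by (rule norm_cauchy_schwarz)
      also have "\<dots> \<le> \<delta> * (2 * B)"
      proof (rule mult_mono)
        show "norm (int_vec l - int_vec k) \<le> 2 * B"
          using norm_triangle_ineq4[of "int_vec l" "int_vec k"] B(2)[OF k(1)] B(2)[OF l(1)] by linarith
      qed (use near \<open>\<epsilon> > 0\<close> B in \<open>auto simp: p_def \<delta>_def\<close>)
      finally show ?thesis
        using B(1) by (simp add: \<delta>_def)
    qed
    ultimately show False by linarith
  qed
  moreover have "\<delta> > 0"
    using B(1) \<open>\<epsilon> > 0\<close> by (simp add: \<delta>_def)
  ultimately show thesis using that by blast
qed

text \<open>
  Shortening the segment according to the length of $w$ keeps the whole of it near $u$.
\<close>
lemma val_zero_near_corner:
  fixes f :: "('d::finite, 'k) laurent_poly"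
  assumes inj: "inj_on (\<lambda>n. \<Sum>i\<in>UNIV. n $ i * w $ i) (Poly_Mapping.keys f)"
    and u: "u \<in> corner_locus nk f" and "\<epsilon> > 0"
  obtains \<delta> where "\<delta> > 0"
    "\<And>a. (\<And>i. a $ i \<noteq> 0) \<Longrightarrow> norm (val nK a - u) < \<delta> \<Longrightarrow>
      \<exists>s x. x \<in> torus_points \<iota> {f} \<and> val nK x = val nK a + s *\<^sub>R int_vec w \<and> dist (val nK x) u < \<epsilon>"
proof -
  define W where "W = 1 + norm (int_vec w)"
  define \<eta> where "\<eta> = \<epsilon> / (2 * W)"
  have "W > 0"
    by (simp add: W_def add_pos_nonneg)
  then have "\<eta> > 0" using \<open>\<epsilon> > 0\<close> by (simp add: \<eta>_def)
  have "\<eta> * norm (int_vec w) \<le> \<eta> * W"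
    using \<open>\<eta> > 0\<close> by (intro mult_left_mono) (auto simp: W_def)
  also have "\<dots> = \<epsilon> / 2"
    using \<open>W > 0\<close> by (simp add: \<eta>_def)
  finally have \<eta>: "\<eta> * norm (int_vec w) \<le> \<epsilon> / 2" .
  obtain \<delta> where \<delta>: "\<delta> > 0" "\<And>a. (\<And>i. a $ i \<noteq> 0) \<Longrightarrow> norm (val nK a - u) < \<delta> \<Longrightarrow>
      \<exists>s x. \<bar>s\<bar> \<le> \<eta> \<and> x \<in> torus_points \<iota> {f} \<and> val nK x = val nK a + s *\<^sub>R int_vec w"
    using val_zero_near_corner_on_line[OF inj u \<open>\<eta> > 0\<close>] by blast
  show thesis
  proof (rule that)
    show "min \<delta> (\<epsilon> / 2) > 0" using \<delta>(1) \<open>\<epsilon> > 0\<close> by simp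
  next
    fix a assume a: "\<And>i. a $ i \<noteq> 0" "norm (val nK a - u) < min \<delta> (\<epsilon> / 2)"
    then obtain s x where x: "\<bar>s\<bar> \<le> \<eta>" "x \<in> torus_points \<iota> {f}"
      "val nK x = val nK a + s *\<^sub>R int_vec w"
      using \<delta>(2)[of a] by auto
    have "dist (val nK x) u \<le> norm (val nK a - u) + \<bar>s\<bar> * norm (int_vec w)"
      using norm_triangle_ineq[of "val nK a - u" "s *\<^sub>R int_vec w"]
      by (simp add: x(3) dist_norm algebra_simps)
    also have "\<dots> < \<epsilon> / 2 + \<epsilon> / 2"
      using a(2) \<eta> mult_right_mono[OF x(1), of "norm (int_vec w)"] by simp
    finally show "\<exists>s x. x \<in> torus_points \<iota> {f} \<and> val nK x = val nK a + s *\<^sub>R int_vec w \<and>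
        dist (val nK x) u < \<epsilon>"
      unfolding field_sum_of_halves using x(2,3) by blast
  qed
qed

theorem tropical_variety_eq_corner_locus:
  fixes f :: "('d::finite, 'k) laurent_poly"
  assumes "f \<noteq> 0"
  shows "tropical_variety \<iota> nK {f} = corner_locus nk f"
proof
  show "tropical_variety \<iota> nK {f} \<subseteq> corner_locus nk f"
    unfolding tropical_variety_def
    using val_zero_in_corner_locus[OF assms] by (intro closure_minimal closed_corner_locus) blast
  show "corner_locus nk f \<subseteq> tropical_variety \<iota> nK {f}"
  proof
    fix u assume u: "u \<in> corner_locus nk f"
    obtain w :: "int ^ 'd" where w: "inj_on (\<lambda>n. \<Sum>i\<in>UNIV. n $ i * w $ i) (Poly_Mapping.keys f)"
      using separating_integer_direction[OF finite_keys] by blast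
    show "u \<in> tropical_variety \<iota> nK {f}"
      unfolding tropical_variety_def closure_approachable
    proof (intro allI impI)
      fix \<epsilon> :: real assume "\<epsilon> > 0"
      obtain \<delta> where \<delta>: "\<delta> > 0" "\<And>a. (\<And>i. a $ i \<noteq> 0) \<Longrightarrow> norm (val nK a - u) < \<delta> \<Longrightarrow>
          \<exists>s x. x \<in> torus_points \<iota> {f} \<and> val nK x = val nK a + s *\<^sub>R int_vec w \<and>
            dist (val nK x) u < \<epsilon>"
        using val_zero_near_corner[OF w u \<open>\<epsilon> > 0\<close>] by blast
      obtain a where "\<And>i. a $ i \<noteq> 0" "norm (val nK a - u) < \<delta>"
        using val_dense[OF \<delta>(1), of u] by blast
      then show "\<exists>v\<in>val nK ` torus_points \<iota> {f}. dist v u < \<epsilon>"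
        using \<delta>(2)[of a] by blast
    qed
  qed
qed

section \<open>Facets of the tropical hypersurface\<close>

lemma aff_dim_tie_cell_le:
  fixes f :: "('d::finite, 'k) laurent_poly"
  assumes "n \<noteq> m"
  shows "aff_dim (tie_cell nk f n m) \<le> int CARD('d) - 1"
proof -
  define c where "c = ln (nk (Poly_Mapping.lookup f n)) - ln (nk (Poly_Mapping.lookup f m))"
  have "tie_cell nk f n m \<subseteq> {u. int_vec (n - m) \<bullet> u = c}"
    unfolding c_def
    by (auto simp: tie_cell_def tropical_term_def int_vec_diff inner_diff_left
        inner_commute[of _ "int_vec _"])
  then have "aff_dim (tie_cell nk f n m) \<le> aff_dim {u. int_vec (n - m) \<bullet> u = c}"
    by (rule aff_dim_subset)
  also have "\<dots> = int CARD('d) - 1"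
    using assms by (subst aff_dim_hyperplane) (auto simp: int_vec_diff int_vec_eq_iff)
  finally show ?thesis .
qed

lemma valuation_diff_in_value_group:
  assumes "c \<noteq> 0" "d \<noteq> 0"
  shows "ln (nk c) - ln (nk d) \<in> value_group nK"
proof -
  define z where "z = \<iota> d * inverse (\<iota> c)"
  have "nk c > 0" "nk d > 0"
    using assms by (auto intro: k.pos)
  moreover have "nK z = nk d * inverse (nk c)"
    by (simp add: z_def K.mult K.inverse norm_extends)
  ultimately have "- ln (nK z) = ln (nk c) - ln (nk d)"
    by (simp add: ln_mult ln_inverse)
  moreover have "z \<noteq> 0"
    using assms by (simp add: z_def embedding_eq_0_iff)
  ultimately have "z \<noteq> 0 \<and> valuation nK z = ereal (ln (nk c) - ln (nk d))"
    by (simp only: valuation_def if_False simp_thms)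
  then show ?thesis
    unfolding value_group_def by (intro CollectI exI)
qed

text \<open>
  A tie of $t_n$ and $t_m$ at the minimum is expressed by $t_m \le t_n$ together with $t_n \le t_k$
  for all $k$; each of these inequalities has integer coefficients and a constant term in the value
  group.
\<close>
lemma rational_polyhedron_tie_cell:
  fixes f :: "('d::finite, 'k) laurent_poly"
  assumes "n \<in> Poly_Mapping.keys f" "m \<in> Poly_Mapping.keys f"
  shows "rational_polyhedron (value_group nK) (tie_cell nk f n m)"
proof -
  let ?K = "Poly_Mapping.keys f"
  define l where "l k = ln (nk (Poly_Mapping.lookup f k))" for k
  define H where "H = insert (n - m, l n - l m) ((\<lambda>k. (k - n, l k - l n)) ` ?K)"
  have term_le: "tropical_term nk f i u \<le> tropical_term nk f k u \<longleftrightarrow> int_vec (k - i) \<bullet> u \<ge> l k - l i"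
    for i k u
    by (auto simp: tropical_term_def l_def int_vec_diff inner_diff_left
        inner_commute[of _ "int_vec _"])
  have "tie_cell nk f n m = {u. tropical_term nk f m u \<le> tropical_term nk f n u \<and>
      (\<forall>k\<in>?K. tropical_term nk f n u \<le> tropical_term nk f k u)}"
    using assms(2) by (auto simp: tie_cell_def intro: antisym)
  then have "tie_cell nk f n m = {u. \<forall>(b, c)\<in>H. int_vec b \<bullet> u \<ge> c}"
    by (simp add: H_def term_le)
  moreover have "snd ` H \<subseteq> value_group nK"
    using assms by (auto simp: H_def l_def in_keys_iff intro: valuation_diff_in_value_group)
  moreover have "finite H" by (simp add: H_def)
  ultimately show ?thesis
    unfolding rational_polyhedron_def by (intro exI[of _ H] conjI)
qed

text \<open>
  Otherwise a small ball around $u$ meets only cells of dimension below $d - 1$. The lines in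
  direction $w$ through these cells fill a negligible closed set, so by density of the value group
  there is a point $\mathrm{val}(a)$ near $u$ outside of it. The line through this point nevertheless
  meets the corner locus near $u$.
\<close>
lemma corner_in_facet:
  fixes f :: "('d::finite, 'k) laurent_poly"
  assumes "f \<noteq> 0" and u: "u \<in> corner_locus nk f"
  obtains n m where "n \<in> Poly_Mapping.keys f" "m \<in> Poly_Mapping.keys f" "n \<noteq> m"
    "aff_dim (tie_cell nk f n m) = int CARD('d) - 1" "u \<in> tie_cell nk f n m"
proof (rule ccontr)
  assume no_facet: "\<not> thesis"
  let ?K = "Poly_Mapping.keys f"
  let ?P = "{(n, m) \<in> ?K \<times> ?K. n \<noteq> m}"
  let ?dim = "\<lambda>(n, m). aff_dim (tie_cell nk f n m)"
  let ?cell = "\<lambda>(n, m). tie_cell nk f n m"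
  define Facets where "Facets = \<Union> (?cell ` {nm \<in> ?P. ?dim nm = int CARD('d) - 1})"
  define Low where "Low = {nm \<in> ?P. ?dim nm < int CARD('d) - 1}"
  have fin: "finite ?P"
    by (auto intro: finite_subset[of _ "?K \<times> ?K"])
  have split: "v \<in> Facets \<or> (\<exists>nm\<in>Low. v \<in> ?cell nm)" if "v \<in> corner_locus nk f" for v
  proof -
    obtain n m where nm: "n \<in> ?K" "m \<in> ?K" "n \<noteq> m" "v \<in> tie_cell nk f n m"
      using \<open>v \<in> corner_locus nk f\<close> by (auto simp: corner_locus_def)
    then show ?thesis
    proof (cases "(n, m) \<in> Low")
      case False
      then have "aff_dim (tie_cell nk f n m) = int CARD('d) - 1"
        using aff_dim_tie_cell_le[OF nm(3), of f] nm by (simp add: Low_def)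
      then show ?thesis
        using nm by (auto simp: Facets_def)
    qed auto
  qed
  have "closed Facets"
    unfolding Facets_def using fin by (intro closed_Union) (auto simp: closed_tie_cell)
  moreover have "u \<notin> Facets"
    using no_facet that by (auto simp: Facets_def)
  ultimately obtain \<epsilon> where \<epsilon>: "\<epsilon> > 0" "ball u \<epsilon> \<subseteq> - Facets"
    by (meson open_Compl ComplI openE)
  obtain w :: "int ^ 'd" where w: "inj_on (\<lambda>n. \<Sum>i\<in>UNIV. n $ i * w $ i) ?K"
    using separating_integer_direction[OF finite_keys] by blast
  obtain \<delta> where \<delta>: "\<delta> > 0"
    "\<And>a. (\<And>i. a $ i \<noteq> 0) \<Longrightarrow> norm (val nK a - u) < \<delta> \<Longrightarrow>
      \<exists>s x. x \<in> torus_points \<iota> {f} \<and> val nK x = val nK a + s *\<^sub>R int_vec w \<and> dist (val nK x) u < \<epsilon>"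
    using val_zero_near_corner[OF w u \<epsilon>(1)] by blast
  have "\<exists>C. closed C \<and> negligible C \<and> (\<forall>p s. p + s *\<^sub>R int_vec w \<in> ?cell nm \<longrightarrow> p \<in> C)"
    if "nm \<in> Low" for nm
  proof -
    have "aff_dim (?cell nm) < int DIM(real ^ 'd) - 1"
      using that by (auto simp: Low_def)
    then show ?thesis by (metis negligible_sweep)
  qed
  then obtain C where C: "\<And>nm. nm \<in> Low \<Longrightarrow> closed (C nm)" "\<And>nm. nm \<in> Low \<Longrightarrow> negligible (C nm)"
    "\<And>nm p s. nm \<in> Low \<Longrightarrow> p + s *\<^sub>R int_vec w \<in> ?cell nm \<Longrightarrow> p \<in> C nm"
    by metis
  have "finite Low" using fin by (simp add: Low_def)
  define U where "U = ball u \<delta> - \<Union> (C ` Low)"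
  have "open U"
    unfolding U_def using C(1) \<open>finite Low\<close> by (intro open_Diff closed_Union) auto
  have "negligible (\<Union> (C ` Low))"
    using C(2) \<open>finite Low\<close> by auto
  then have "\<not> ball u \<delta> \<subseteq> \<Union> (C ` Low)"
    using \<delta>(1) open_not_negligible[of "ball u \<delta>"] by (metis ball_eq_empty negligible_subset not_le open_ball)
  then obtain q where "q \<in> U" unfolding U_def by blast
  then obtain \<eta> where \<eta>: "\<eta> > 0" "ball q \<eta> \<subseteq> U"
    using \<open>open U\<close> by (meson openE)
  obtain a where a: "\<And>i. a $ i \<noteq> 0" "norm (val nK a - q) < \<eta>"
    using val_dense[OF \<eta>(1), of q] by blast
  then have "val nK a \<in> U"
    using \<eta>(2) by (auto simp: dist_norm norm_minus_commute)
  then have "norm (val nK a - u) < \<delta>"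
    by (simp add: U_def dist_norm norm_minus_commute)
  then obtain s x where x: "x \<in> torus_points \<iota> {f}" "val nK x = val nK a + s *\<^sub>R int_vec w"
    "dist (val nK x) u < \<epsilon>"
    using \<delta>(2) a(1) by blast
  have "val nK x \<notin> Facets"
    using x(3) \<epsilon>(2) by (auto simp: dist_commute)
  then obtain nm where "nm \<in> Low" "val nK x \<in> ?cell nm"
    using split val_zero_in_corner_locus[OF assms(1) x(1)] by blast
  then have "val nK a \<in> C nm"
    using C(3)[of nm "val nK a" s] x(2) by simp
  then show False
    using \<open>val nK a \<in> U\<close> \<open>nm \<in> Low\<close> unfolding U_def by blast
qed

text \<open>
  The cells of dimension $d - 1$ already cover the corner locus. In the decomposition that consists
  of these alone, every member has the required dimension, maximal or not.
\<close>
theorem pure_rational_polyhedral_corner_locus: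
  fixes f :: "('d::finite, 'k) laurent_poly"
  assumes "f \<noteq> 0"
  shows "pure_rational_polyhedral_set (value_group nK) (int CARD('d) - 1) (corner_locus nk f)"
proof -
  let ?K = "Poly_Mapping.keys f"
  define F where "F = {tie_cell nk f n m | n m. n \<in> ?K \<and> m \<in> ?K \<and> n \<noteq> m \<and>
    aff_dim (tie_cell nk f n m) = int CARD('d) - 1}"
  have "F \<subseteq> (\<lambda>(n, m). tie_cell nk f n m) ` (?K \<times> ?K)"
    by (auto simp: F_def)
  then have "finite F"
    by (rule finite_subset) simp
  moreover have "corner_locus nk f = \<Union> F"
  proof
    show "corner_locus nk f \<subseteq> \<Union> F"
    proof
      fix u assume "u \<in> corner_locus nk f"
      then obtain n m where "n \<in> ?K" "m \<in> ?K" "n \<noteq> m"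
        "aff_dim (tie_cell nk f n m) = int CARD('d) - 1" "u \<in> tie_cell nk f n m"
        by (rule corner_in_facet[OF assms])
      then show "u \<in> \<Union> F"
        unfolding F_def by (intro UnionI[of "tie_cell nk f n m"]) auto
    qed
    show "\<Union> F \<subseteq> corner_locus nk f"
      by (auto simp: F_def corner_locus_def)
  qed
  moreover have "\<forall>P\<in>F. rational_polyhedron (value_group nK) P \<and> aff_dim P = int CARD('d) - 1"
    using rational_polyhedron_tie_cell by (auto simp: F_def)
  ultimately show ?thesis
    unfolding pure_rational_polyhedral_set_def by metis
qed

text \<open>
  Two terms of $f$ remain two nonzero coefficients on a curve in a separating direction, and a
  nonzero root of the restriction gives a point of the torus.
\<close>
lemma zero_exists_if_not_monomial:
  fixes f :: "('d::finite, 'k) laurent_poly"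
  assumes "f \<noteq> 0" "\<not> is_monomial f"
  obtains x where "x \<in> torus_points \<iota> {f}"
proof -
  let ?K = "Poly_Mapping.keys f"
  obtain n where n: "n \<in> ?K"
    using assms(1) by (metis ex_in_conv keys_eq_empty)
  obtain m where m: "m \<in> ?K" "m \<noteq> n"
  proof (rule ccontr)
    assume "\<not> thesis"
    then have "Poly_Mapping.lookup f k = 0" if "k \<noteq> n" for k
      using that \<open>\<And>m. m \<in> ?K \<Longrightarrow> m \<noteq> n \<Longrightarrow> thesis\<close> by (metis in_keys_iff)
    then have "f = Poly_Mapping.single n (Poly_Mapping.lookup f n)"
      by (intro poly_mapping_eqI) (auto simp: lookup_single when_def)
    then show False
      using assms(2) n unfolding is_monomial_def by (metis in_keys_iff)
  qed
  obtain w :: "int ^ 'd" where w: "inj_on (\<lambda>n. \<Sum>i\<in>UNIV. n $ i * w $ i) ?K"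
    using separating_integer_direction[OF finite_keys] by blast
  define a :: "'K ^ 'd" where "a = (\<chi> i. 1)"
  obtain g e where e: "inj_on e ?K"
    and g: "\<forall>n\<in>?K. coeff g (e n) = laurent_term \<iota> f a n"
      "\<forall>j. coeff g j \<noteq> 0 \<longrightarrow> j \<in> e ` ?K"
      "\<forall>y. y \<noteq> 0 \<longrightarrow> poly g y = 0 \<longleftrightarrow> laurent_eval \<iota> f (monomial_curve a w y) = 0"
    by (rule restriction_to_monomial_curve[OF w, of \<iota> a])
  have "coeff g (e n) \<noteq> 0" "coeff g (e m) \<noteq> 0" "e n \<noteq> e m"
    using n m g(1) e laurent_term_nonzero[of _ f a] by (auto simp: a_def inj_on_def)
  then obtain y where y: "y \<noteq> 0" "poly g y = 0"
    using nonzero_root_if_two_coeffs by blast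
  then have "monomial_curve a w y \<in> torus_points \<iota> {f}"
    using g(3) by (simp add: torus_points_def monomial_curve_def a_def)
  then show thesis using that by blast
qed

end

theorem theorem2p1p1:
  fixes nk :: "'k::field \<Rightarrow> real"
    and nK :: "'K::alg_closed_field \<Rightarrow> real"
    and \<iota> :: "'k \<Rightarrow> 'K"
    and f :: "('d::finite, 'k) laurent_poly"
  assumes "complete_nonarch_field nk"
    and "algebraic_closure \<iota>"
    and "nonarch_norm nK"
    and "\<And>a. nK (\<iota> a) = nk a"
  shows "(f \<noteq> 0 \<longrightarrow>
            tropical_variety \<iota> nK {f} = {u. \<not> (tropicalization nk f) differentiable (at u)}) \<and>
         (is_monomial f \<longrightarrow> tropical_variety \<iota> nK {f} = {}) \<and>
         (f \<noteq> 0 \<and> \<not> is_monomial f \<longrightarrow>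
            tropical_variety \<iota> nK {f} \<noteq> {} \<and>
            pure_rational_polyhedral_set (value_group nK) (int CARD('d) - 1)
              (tropical_variety \<iota> nK {f})) \<and>
         (f = 0 \<longrightarrow> tropical_variety \<iota> nK {f} = UNIV)"
proof -
  interpret valued_algebraic_closure nk \<iota> nK
    using assms by (simp add: valued_algebraic_closure_def valued_algebraic_closure_axioms_def)
  have "tropical_variety \<iota> nK {f} = {u. \<not> (tropicalization nk f) differentiable (at u)}" if "f \<noteq> 0"
    using tropical_variety_eq_corner_locus[OF that] corner_locus_eq_nondifferentiable[OF that] by metis
  moreover have "tropical_variety \<iota> nK {f} = {}" if "is_monomial f"
  proof -
    obtain n a where f: "f = Poly_Mapping.single n a" "a \<noteq> 0"
      using \<open>is_monomial f\<close> by (auto simp: is_monomial_def)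
    then have "corner_locus nk f = {}"
      by (auto simp: corner_locus_def)
    moreover have "f \<noteq> 0"
      using f by (metis keys_eq_empty keys_single insert_not_empty)
    ultimately show ?thesis
      using tropical_variety_eq_corner_locus by metis
  qed
  moreover have "tropical_variety \<iota> nK {f} \<noteq> {}" if "f \<noteq> 0" "\<not> is_monomial f"
    using zero_exists_if_not_monomial[OF that] unfolding tropical_variety_def
    by (metis closure_eq_empty empty_iff image_is_empty)
  moreover have "pure_rational_polyhedral_set (value_group nK) (int CARD('d) - 1)
      (tropical_variety \<iota> nK {f})" if "f \<noteq> 0"
    using pure_rational_polyhedral_corner_locus[OF that] tropical_variety_eq_corner_locus[OF that]
    by simp
  moreover have "tropical_variety \<iota> nK {f} = UNIV" if "f = 0"
  proof -
    have "torus_points \<iota> {f} = {x. \<forall>i. x $ i \<noteq> 0}"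
      using that by (simp add: torus_points_def laurent_eval_def)
    then show ?thesis
      unfolding tropical_variety_def
      by (auto simp: closure_approachable dist_norm) (metis val_dense)
  qed
  ultimately show ?thesis by blast
qed

end
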